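(* Let $\mathbb{R}^2$ be the Euclidean space with the standard coordinates $(x,y)$ and the metric $ds^2=dx^2+dy^2$. Let $N$ be the circular cone in $\mathbb{R}^3$ with parametrization $\vec r(u,v)=\left(\frac{u}{\sqrt2}\cos v,\frac{u}{\sqrt2}\sin v,\frac{u}{\sqrt2}\right)$ and the metric induced from $\mathbb{R}^3$. Then the map $\phi:\mathbb{R}^2\to N$ defined, in the coordinates $(u,v)$ on $N$, by $\phi(x,y)=(f(x),y)$, where $f$ is a smooth real function of $x$, is biharmonic if and only if $f(x)=(A+Bx)e^{x/\sqrt2}+(C+Dx)e^{-x/\sqrt2}$ for some real constants $A,B,C,D$. It is proper biharmonic when $B^2+D^2\neq0$.
   Context: All manifolds, maps and tensor fields are assumed to be smooth. For a map $\phi:(M,g)\to(N,h)$ between Riemannian manifolds the tension field is $\tau(\phi)=\mathrm{Trace}_g\nabla d\phi$; $\phi$ is harmonic if $\tau(\phi)=0$. It is biharmonic if it is a critical point of $\frac12\int_\Omega|\tau(\phi)|^2v_g$ for every compact subset $\Omega$ of $M$, equivalently if $$\tau^2(\phi)=\mathrm{Trace}_g\big(\nabla^\phi\nabla^\phi-\nabla^\phi_{\nabla^M}\big)\tau(\phi)-\mathrm{Trace}_g R^N(d\phi,\tau(\phi))\,d\phi=0,$$ with $R^N(X,Y)Z=[\nabla^N_X,\nabla^N_Y]Z-\nabla^N_{[X,Y]}Z$. A biharmonic map is proper if it is not harmonic. In the coordinates $(u,v)$ the induced metric on the cone is $du^2+\frac12u^2dv^2$. *)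

theory Defs
  imports "HOL-Analysis.Analysis"
begin

section \<open>Riemannian geometry in local coordinates\<close>

text \<open>
  A metric in coordinates is a field \<open>g\<close> of symmetric positive definite matrices. Tangent vectors,
  vector fields and sections of pulled-back tangent bundles are given by their components in the
  coordinate frame, so all of them are vector-valued functions. The values of the operators below
  are meaningful only at points where the metrics involved are nondegenerate and all fields are
  smooth.
\<close>

type_synonym 'n metric = "real^'n \<Rightarrow> real^'n^'n"

definition smooth_real :: "(real \<Rightarrow> real) \<Rightarrow> bool" where
  "smooth_real f \<longleftrightarrow> (\<forall>k x. (deriv ^^ k) f differentiable (at x))"

abbreviation ddir :: "('a::real_normed_vector \<Rightarrow> 'b::real_normed_vector) \<Rightarrow> 'a \<Rightarrow> 'a \<Rightarrow> 'b" where
  "ddir F p a \<equiv> frechet_derivative F (at p) a"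

definition coord_field :: "'n \<Rightarrow> real^'n \<Rightarrow> real^'n::finite" where
  "coord_field i = (\<lambda>_. axis i 1)"

abbreviation partial :: "'n \<Rightarrow> (real^'n \<Rightarrow> 'b::real_normed_vector) \<Rightarrow> real^'n::finite \<Rightarrow> 'b" where
  "partial i F p \<equiv> ddir F p (axis i 1)"

definition flat_metric :: "'n::finite metric" where
  "flat_metric = (\<lambda>_. mat 1)"

definition induced_metric :: "(real^'n::finite \<Rightarrow> 'e::euclidean_space) \<Rightarrow> 'n metric" where
  "induced_metric r = (\<lambda>p. \<chi> i j. partial i r p \<bullet> partial j r p)"

definition metric_trace ::
    "'n::finite metric \<Rightarrow> real^'n \<Rightarrow> ('n \<Rightarrow> 'n \<Rightarrow> 'b::real_vector) \<Rightarrow> 'b" where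
  "metric_trace g p T = (\<Sum>i\<in>UNIV. \<Sum>j\<in>UNIV. matrix_inv (g p) $ i $ j *\<^sub>R T i j)"

text \<open>\<open>christoffel g p k i j\<close> is the symbol with upper index \<open>k\<close> and lower indices \<open>i\<close>, \<open>j\<close>.\<close>

definition christoffel :: "'n::finite metric \<Rightarrow> real^'n \<Rightarrow> 'n \<Rightarrow> 'n \<Rightarrow> 'n \<Rightarrow> real" where
  "christoffel g p k i j =
     (\<Sum>l\<in>UNIV. matrix_inv (g p) $ k $ l *
        (partial i (\<lambda>q. g q $ j $ l) p + partial j (\<lambda>q. g q $ i $ l) p
         - partial l (\<lambda>q. g q $ i $ j) p)) / 2"

definition christoffel_form :: "'n::finite metric \<Rightarrow> real^'n \<Rightarrow> real^'n \<Rightarrow> real^'n \<Rightarrow> real^'n" where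
  "christoffel_form g p a b =
     (\<chi> k. \<Sum>i\<in>UNIV. \<Sum>j\<in>UNIV. christoffel g p k i j * a $ i * b $ j)"

definition levi_civita ::
    "'n::finite metric \<Rightarrow> (real^'n \<Rightarrow> real^'n) \<Rightarrow> (real^'n \<Rightarrow> real^'n) \<Rightarrow> real^'n \<Rightarrow> real^'n" where
  "levi_civita g X Y p = ddir Y p (X p) + christoffel_form g p (X p) (Y p)"

definition pullback_connection ::
    "'n::finite metric \<Rightarrow> (real^'m::finite \<Rightarrow> real^'n) \<Rightarrow>
     (real^'m \<Rightarrow> real^'m) \<Rightarrow> (real^'m \<Rightarrow> real^'n) \<Rightarrow> real^'m \<Rightarrow> real^'n" where
  "pullback_connection h \<phi> X V p =
     ddir V p (X p) + christoffel_form h (\<phi> p) (ddir \<phi> p (X p)) (V p)"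

definition lie_bracket ::
    "(real^'n::finite \<Rightarrow> real^'n) \<Rightarrow> (real^'n \<Rightarrow> real^'n) \<Rightarrow> real^'n \<Rightarrow> real^'n" where
  "lie_bracket X Y p = ddir Y p (X p) - ddir X p (Y p)"

definition curvature_op ::
    "'n::finite metric \<Rightarrow> (real^'n \<Rightarrow> real^'n) \<Rightarrow> (real^'n \<Rightarrow> real^'n) \<Rightarrow>
     (real^'n \<Rightarrow> real^'n) \<Rightarrow> real^'n \<Rightarrow> real^'n" where
  "curvature_op g X Y Z p =
     levi_civita g X (levi_civita g Y Z) p - levi_civita g Y (levi_civita g X Z) p
     - levi_civita g (lie_bracket X Y) Z p"

text \<open>
  The curvature operator is tensorial, so its value on tangent vectors at a point can be computed
  from any extensions to vector fields; here those with constant components.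
\<close>

definition curvature_tensor ::
    "'n::finite metric \<Rightarrow> real^'n \<Rightarrow> real^'n \<Rightarrow> real^'n \<Rightarrow> real^'n \<Rightarrow> real^'n" where
  "curvature_tensor g p a b c = curvature_op g (\<lambda>_. a) (\<lambda>_. b) (\<lambda>_. c) p"

section \<open>Harmonic and biharmonic maps\<close>

definition second_fundamental_form ::
    "'m::finite metric \<Rightarrow> 'n::finite metric \<Rightarrow> (real^'m \<Rightarrow> real^'n) \<Rightarrow>
     (real^'m \<Rightarrow> real^'m) \<Rightarrow> (real^'m \<Rightarrow> real^'m) \<Rightarrow> real^'m \<Rightarrow> real^'n" where
  "second_fundamental_form g h \<phi> X Y p =
     pullback_connection h \<phi> X (\<lambda>q. ddir \<phi> q (Y q)) p - ddir \<phi> p (levi_civita g X Y p)"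

definition tension_field ::
    "'m::finite metric \<Rightarrow> 'n::finite metric \<Rightarrow> (real^'m \<Rightarrow> real^'n) \<Rightarrow> real^'m \<Rightarrow> real^'n" where
  "tension_field g h \<phi> p =
     metric_trace g p
       (\<lambda>i j. second_fundamental_form g h \<phi> (coord_field i) (coord_field j) p)"

definition bitension_field ::
    "'m::finite metric \<Rightarrow> 'n::finite metric \<Rightarrow> (real^'m \<Rightarrow> real^'n) \<Rightarrow> real^'m \<Rightarrow> real^'n" where
  "bitension_field g h \<phi> p =
     (let \<tau> = tension_field g h \<phi>; D = pullback_connection h \<phi>; X = coord_field in
        metric_trace g p
          (\<lambda>i j. D (X i) (D (X j) \<tau>) p - D (levi_civita g (X i) (X j)) \<tau> p)
        - metric_trace g p
          (\<lambda>i j. curvature_tensor h (\<phi> p) (ddir \<phi> p (X i p)) (\<tau> p) (ddir \<phi> p (X j p))))"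

text \<open>
  \<open>U\<close> is an open set of the coordinate domain which \<open>\<phi>\<close> maps into the region where \<open>h\<close> is a
  Riemannian metric. Biharmonicity is taken in the form of the Euler--Lagrange equation of the
  bienergy.
\<close>

definition harmonic_on ::
    "(real^'m) set \<Rightarrow> 'm::finite metric \<Rightarrow> 'n::finite metric \<Rightarrow> (real^'m \<Rightarrow> real^'n) \<Rightarrow> bool" where
  "harmonic_on U g h \<phi> \<longleftrightarrow> (\<forall>p\<in>U. tension_field g h \<phi> p = 0)"

definition biharmonic_on ::
    "(real^'m) set \<Rightarrow> 'm::finite metric \<Rightarrow> 'n::finite metric \<Rightarrow> (real^'m \<Rightarrow> real^'n) \<Rightarrow> bool" where
  "biharmonic_on U g h \<phi> \<longleftrightarrow> (\<forall>p\<in>U. bitension_field g h \<phi> p = 0)"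

definition proper_biharmonic_on ::
    "(real^'m) set \<Rightarrow> 'm::finite metric \<Rightarrow> 'n::finite metric \<Rightarrow> (real^'m \<Rightarrow> real^'n) \<Rightarrow> bool" where
  "proper_biharmonic_on U g h \<phi> \<longleftrightarrow> biharmonic_on U g h \<phi> \<and> \<not> harmonic_on U g h \<phi>"

section \<open>The circular cone\<close>

definition cone_param :: "real^2 \<Rightarrow> real^3" where
  "cone_param q =
     vector [q $ 1 / sqrt 2 * cos (q $ 2), q $ 1 / sqrt 2 * sin (q $ 2), q $ 1 / sqrt 2]"

definition cone_metric :: "2 metric" where
  "cone_metric = induced_metric cone_param"

text \<open>
  The parametrization is an immersion exactly off \<open>u = 0\<close>, which it collapses to the vertex. Away
  from there it restricts to local charts of the cone minus its vertex, both nappes included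
  (\<open>v\<close> is only determined modulo \<open>2\<pi>\<close>).
\<close>

definition cone_regular :: "(real^2) set" where
  "cone_regular = {q. q $ 1 \<noteq> 0}"

definition cone_map :: "(real \<Rightarrow> real) \<Rightarrow> real^2 \<Rightarrow> real^2" where
  "cone_map f p = vector [f (p $ 1), p $ 2]"

text \<open>
  A function \<open>f\<close> with zeros sends points to the vertex, where the cone carries no Riemannian
  structure; the map is then considered on the open set of points sent to the regular part. If
  \<open>f\<close> has no zeros this is the whole plane.
\<close>

definition cone_map_domain :: "(real \<Rightarrow> real) \<Rightarrow> (real^2) set" where
  "cone_map_domain f = cone_map f -` cone_regular"

lemma cone_param_has_derivative:
  "(cone_param has_derivative
     (\<lambda>a. vector [a $ 1 / sqrt 2 * cos (q $ 2) - q $ 1 / sqrt 2 * sin (q $ 2) * a $ 2,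
                   a $ 1 / sqrt 2 * sin (q $ 2) + q $ 1 / sqrt 2 * cos (q $ 2) * a $ 2,
                   a $ 1 / sqrt 2])) (at q)"
proof -
  have sq: "sqrt 2 * (sqrt 2 * z) = 2 * z" for z :: real
    by (simp flip: mult.assoc)
  have "((\<lambda>p. cone_param p $ i) has_derivative
     (\<lambda>a. (vector [a $ 1 / sqrt 2 * cos (q $ 2) - q $ 1 / sqrt 2 * sin (q $ 2) * a $ 2,
                   a $ 1 / sqrt 2 * sin (q $ 2) + q $ 1 / sqrt 2 * cos (q $ 2) * a $ 2,
                   a $ 1 / sqrt 2] :: real^3) $ i)) (at q)" for i
  proof -
    consider "i = 1" | "i = 2" | "i = 3" using exhaust_3 by blast
    then show ?thesis
      unfolding cone_param_def
      by cases (auto intro!: derivative_eq_intros bounded_linear.has_derivative[OF bounded_linear_vec_nth]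
                  simp: fun_eq_iff field_simps sq)
  qed
  then show ?thesis
    unfolding has_derivative_componentwise_within[of cone_param]
    by (auto simp: Basis_vec_def inner_axis)
qed

lemma cone_metric_eq:
  "cone_metric q = vector [vector [1, 0], vector [0, (q $ 1)\<^sup>2 / 2]]"
proof -
  have 1: "(q $ 1 * sin (q $ 2))\<^sup>2 + (q $ 1 * cos (q $ 2))\<^sup>2 = (q $ 1)\<^sup>2"
    by (simp add: power_mult_distrib flip: distrib_left)
  have 2: "2 * (cos (q $ 2) * cos (q $ 2)) + 2 * (sin (q $ 2) * sin (q $ 2)) = (2::real)"
    using sin_cos_squared_add3[of "q $ 2"] by linarith
  show ?thesis
    unfolding cone_metric_def induced_metric_def frechet_derivative_at[OF cone_param_has_derivative, symmetric]
    using 1 2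
    by (auto simp: vec_eq_iff forall_2 inner_vec_def sum_3 axis_def field_simps power2_eq_square)
qed

end

theory Submission imports Defs begin

text \<open>
  In the coordinates \<open>(u, v)\<close> the only nonzero connection terms of the cone are
  \<open>\<nabla>\<^sub>v \<partial>\<^sub>v = - (u / 2) \<partial>\<^sub>u\<close> and \<open>\<nabla>\<^sub>u \<partial>\<^sub>v = \<nabla>\<^sub>v \<partial>\<^sub>u = (1 / u) \<partial>\<^sub>v\<close>. Hence the tension field of
  \<open>(x, y) \<mapsto> (f x, y)\<close> is \<open>w \<partial>\<^sub>u\<close> with \<open>w = f'' - f / 2\<close>. The cone is flat, so the curvature term
  of the bitension field vanishes, and the rough Laplacian of \<open>w \<partial>\<^sub>u\<close> is \<open>(w'' - w / 2) \<partial>\<^sub>u\<close>: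
  the derivative in \<open>y\<close> turns \<open>w \<partial>\<^sub>u\<close> into \<open>(w / f) \<partial>\<^sub>v\<close> and this into \<open>- (w / 2) \<partial>\<^sub>u\<close>. With
  \<open>L = d\<^sup>2/dx\<^sup>2 - 1/2\<close>, harmonicity is thus \<open>L f = 0\<close> and biharmonicity is
  \<open>L (L f) = f'''' - f'' + f / 4 = 0\<close> (\<open>tension_cone_map\<close>, \<open>bitension_cone_map\<close>).

  Both equations are obtained only where \<open>f \<noteq> 0\<close>, since the zeros of \<open>f\<close> go to the vertex. They hold
  on the whole line nevertheless: a linear homogeneous expression in \<open>f\<close> and its derivatives
  vanishes in the interior of the zero set of \<open>f\<close> as well, and the points left over are limits of
  points with \<open>f \<noteq> 0\<close> (\<open>linear_ode_extends_over_zeros\<close>). The equation \<open>L (L f) = 0\<close> is then solved by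
  solving a second order equation twice, first for \<open>w = L f\<close> and next for the difference of \<open>f\<close> and
  a particular solution of \<open>L h = w\<close>. On the resulting functions \<open>L\<close> removes the coefficients \<open>A\<close>, \<open>C\<close>
  and keeps \<open>B\<close>, \<open>D\<close> up to constant factors, which is why the map is not harmonic once \<open>B\<close> or \<open>D\<close>
  is nonzero.
\<close>

section \<open>Constant-coefficient equations for smooth real functions\<close>

lemma smooth_real_has_derivative:
  assumes "smooth_real f"
  shows "((deriv ^^ k) f has_real_derivative (deriv ^^ Suc k) f x) (at x)"
  using assms DERIV_deriv_iff_real_differentiable[of "(deriv ^^ k) f" x]
  unfolding smooth_real_def by simp

lemma iterated_deriv_vanishes_on_open:
  fixes f :: "real \<Rightarrow> real"
  assumes "open S" "\<And>x. x \<in> S \<Longrightarrow> f x = 0" "x \<in> S"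
  shows "(deriv ^^ k) f x = 0"
  using \<open>x \<in> S\<close>
proof (induction k arbitrary: x)
  case (Suc k)
  have "((deriv ^^ k) f has_real_derivative 0) (at x)"
    using DERIV_const[of "0::real"]
    by (rule has_field_derivative_transform_within_open[OF _ \<open>open S\<close> Suc.prems]) (simp add: Suc.IH)
  then show ?case by (simp add: DERIV_imp_deriv)
qed (use assms in auto)

text \<open>
  If the expression \<open>G\<close> were nonzero at \<open>x\<close>, it would be nonzero on an open neighbourhood of \<open>x\<close>. There
  \<open>f\<close> has to vanish, hence so do all its derivatives, hence so does \<open>G\<close>.
\<close>

lemma linear_ode_extends_over_zeros:
  fixes c :: "nat \<Rightarrow> real"
  assumes "smooth_real f"
    and "\<And>x. f x \<noteq> 0 \<Longrightarrow> (\<Sum>k\<le>n. c k * (deriv ^^ k) f x) = 0"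
  shows "(\<Sum>k\<le>n. c k * (deriv ^^ k) f x) = 0"
proof (rule ccontr)
  define G where "G x = (\<Sum>k\<le>n. c k * (deriv ^^ k) f x)" for x
  assume "(\<Sum>k\<le>n. c k * (deriv ^^ k) f x) \<noteq> 0"
  then have x: "x \<in> {x. G x \<noteq> 0}" by (simp add: G_def)
  have "continuous_on UNIV ((deriv ^^ k) f)" for k
    using smooth_real_has_derivative[OF assms(1)]
    by (intro continuous_at_imp_continuous_on ballI DERIV_isCont)
  then have "continuous_on UNIV G"
    unfolding G_def by (intro continuous_intros) auto
  then have "open {x. G x \<noteq> 0}"
    by (intro open_Collect_neq continuous_on_const)
  moreover have "f y = 0" if "y \<in> {x. G x \<noteq> 0}" for y
    using that assms(2) unfolding G_def by blast
  ultimately have "(deriv ^^ k) f x = 0" for k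
    using iterated_deriv_vanishes_on_open x by metis
  with x show False by (simp add: G_def)
qed

text \<open>
  The operator \<open>d\<^sup>2/dx\<^sup>2 - c\<^sup>2\<close> factors as \<open>(d/dx - s) (d/dx + s)\<close> for \<open>s = c\<close> and for \<open>s = - c\<close>, so
  \<open>w' + s w\<close> is a multiple of \<open>exp (s x)\<close> for both signs; \<open>w\<close> is read off from the difference.
\<close>

lemma second_order_ode_solution:
  fixes w :: "real \<Rightarrow> real"
  assumes w: "\<And>x. (w has_real_derivative w' x) (at x)"
    and w': "\<And>x. (w' has_real_derivative c\<^sup>2 * w x) (at x)"
    and "c \<noteq> 0"
  obtains a b where "\<And>x. w x = a * exp (c * x) + b * exp (- (c * x))"
proof -
  have "\<exists>K. \<forall>x. w' x + s * w x = K * exp (s * x)" if s: "s\<^sup>2 = c\<^sup>2" for s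
  proof -
    have "((\<lambda>x. (w' x + s * w x) * exp (- (s * x))) has_real_derivative 0) (at x)" for x
      using s by (auto intro!: derivative_eq_intros w w' simp: algebra_simps power2_eq_square)
    then have const: "(w' x + s * w x) * exp (- (s * x)) = w' 0 + s * w 0" for x
      using DERIV_isconst_all[of "\<lambda>x. (w' x + s * w x) * exp (- (s * x))" x 0] by simp
    have "w' x + s * w x = (w' 0 + s * w 0) * exp (s * x)" for x
      unfolding const[of x, symmetric] by (simp add: exp_minus)
    then show ?thesis by blast
  qed
  from this[of c] this[of "- c"] obtain K L
    where K: "\<And>x. w' x + c * w x = K * exp (c * x)"
      and L: "\<And>x. w' x - c * w x = L * exp (- (c * x))"
    by auto
  have "w x = K / (2 * c) * exp (c * x) + (- L / (2 * c)) * exp (- (c * x))" for x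
    using K[of x] L[of x] \<open>c \<noteq> 0\<close> by (simp add: field_simps)
  then show ?thesis by (rule that)
qed

section \<open>The biharmonic profiles\<close>

text \<open>
  The four parameters make the family closed under differentiation, which then acts on them
  linearly; this reduces differential equations for profiles to linear algebra.
\<close>

definition biharmonic_profile :: "real \<Rightarrow> real \<Rightarrow> real \<Rightarrow> real \<Rightarrow> real \<Rightarrow> real" where
  "biharmonic_profile A B C D x =
     (A + B * x) * exp (x / sqrt 2) + (C + D * x) * exp (- x / sqrt 2)"

lemma sqrt2_mult_sqrt2: "sqrt 2 * (sqrt 2 * z) = 2 * z" for z :: real
  by (simp flip: mult.assoc)

lemma biharmonic_profile_derivative:
  "(biharmonic_profile A B C D has_real_derivative
     biharmonic_profile (A / sqrt 2 + B) (B / sqrt 2) (D - C / sqrt 2) (- D / sqrt 2) x) (at x)"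
  unfolding biharmonic_profile_def
  by (rule derivative_eq_intros refl | simp)+ (simp add: field_simps sqrt2_mult_sqrt2)

lemma deriv_biharmonic_profile:
  "deriv (biharmonic_profile A B C D) =
     biharmonic_profile (A / sqrt 2 + B) (B / sqrt 2) (D - C / sqrt 2) (- D / sqrt 2)"
  by (rule ext, rule DERIV_imp_deriv, rule biharmonic_profile_derivative)

lemma deriv2_biharmonic_profile:
  "deriv (deriv (biharmonic_profile A B C D)) =
     biharmonic_profile (A / 2 + sqrt 2 * B) (B / 2) (C / 2 - sqrt 2 * D) (D / 2)"
proof -
  have "(A / sqrt 2 + B) / sqrt 2 + B / sqrt 2 = A / 2 + sqrt 2 * B" for A B :: real
    by (simp add: field_simps sqrt2_mult_sqrt2)
  from this[of A B] this[of C "- D"] show ?thesis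
    by (simp add: deriv_biharmonic_profile add_divide_distrib diff_divide_distrib add.commute)
qed

text \<open>
  This shows that a profile is annihilated by \<open>d\<^sup>2/dx\<^sup>2 - 1/2\<close> only if \<open>B = D = 0\<close>, and it provides
  particular solutions of the inhomogeneous second order equation.
\<close>

lemma biharmonic_profile_tension:
  "(deriv ^^ 2) (biharmonic_profile A B C D) x - biharmonic_profile A B C D x / 2
     = biharmonic_profile (sqrt 2 * B) 0 (- sqrt 2 * D) 0 x"
proof -
  \<comment> \<open>The identity is polynomial in \<open>sqrt 2\<close> and the two exponentials, so these may be arbitrary numbers.\<close>
  have "(A / 2 + s * B + B / 2 * x) * e + (C / 2 - s * D + D / 2 * x) * e'
      - ((A + B * x) * e + (C + D * x) * e') / 2
      = (s * B + 0 * x) * e + (- s * D + 0 * x) * e'" for s e e' :: real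
    by (simp add: field_simps)
  then show ?thesis
    by (simp only: numeral_2_eq_2 funpow.simps comp_apply id_apply deriv2_biharmonic_profile
          biharmonic_profile_def[of _ _ _ _ x])
qed

text \<open>
  The equation says \<open>w'' = w / 2\<close> for \<open>w = f'' - f / 2\<close>. By
  \<open>biharmonic_profile_tension\<close> there is a profile \<open>h\<close> with \<open>A = C = 0\<close> and \<open>h'' - h / 2 = w\<close>, so that \<open>f - h\<close> satisfies the homogeneous equation.
\<close>

lemma fourth_order_ode_iff:
  assumes "smooth_real f"
  shows "(\<forall>x. (deriv ^^ 4) f x - (deriv ^^ 2) f x + f x / 4 = 0)
     \<longleftrightarrow> (\<exists>A B C D. f = biharmonic_profile A B C D)"
proof
  note d = smooth_real_has_derivative[OF assms, simplified]
  assume ode: "\<forall>x. (deriv ^^ 4) f x - (deriv ^^ 2) f x + f x / 4 = 0"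
  define w where "w x = deriv (deriv f) x - f x / 2" for x
  define w' where "w' x = deriv (deriv (deriv f)) x - deriv f x / 2" for x
  have "(w has_real_derivative w' x) (at x)" for x
    unfolding w_def w'_def using d[of 2 x] d[of 0 x]
    by (auto intro!: derivative_eq_intros simp: numeral_2_eq_2)
  moreover have "(w' has_real_derivative (1 / sqrt 2)\<^sup>2 * w x) (at x)" for x
  proof -
    have "(w' has_real_derivative (deriv ^^ 4) f x - deriv (deriv f) x / 2) (at x)"
      unfolding w'_def using d[of 3 x] d[of 1 x]
      by (auto intro!: derivative_eq_intros simp: eval_nat_numeral)
    also have "(deriv ^^ 4) f x - deriv (deriv f) x / 2 = (1 / sqrt 2)\<^sup>2 * w x"
      using ode[rule_format, of x] by (simp add: w_def power_divide numeral_2_eq_2 field_simps)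
    finally show ?thesis .
  qed
  ultimately obtain a b where w: "\<And>x. w x = a * exp (1 / sqrt 2 * x) + b * exp (- (1 / sqrt 2 * x))"
    by (rule second_order_ode_solution) auto
  define h where "h = biharmonic_profile 0 (a / sqrt 2) 0 (- b / sqrt 2)"
  have h: "deriv (deriv h) x - h x / 2 = w x" for x
    using biharmonic_profile_tension[of 0 "a / sqrt 2" 0 "- b / sqrt 2" x]
    by (simp add: h_def w numeral_2_eq_2 biharmonic_profile_def)
  have "((\<lambda>x. f x - h x) has_real_derivative deriv f x - deriv h x) (at x)" for x
    using d[of 0 x] unfolding h_def deriv_biharmonic_profile
    by (auto intro!: derivative_eq_intros biharmonic_profile_derivative)
  moreover have "((\<lambda>x. deriv f x - deriv h x) has_real_derivative (1 / sqrt 2)\<^sup>2 * (f x - h x)) (at x)" for x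
  proof -
    have "((\<lambda>x. deriv f x - deriv h x) has_real_derivative deriv (deriv f) x - deriv (deriv h) x) (at x)"
      using d[of 1 x] unfolding h_def deriv_biharmonic_profile
      by (auto intro!: derivative_eq_intros biharmonic_profile_derivative)
    also have "deriv (deriv f) x - deriv (deriv h) x = (1 / sqrt 2)\<^sup>2 * (f x - h x)"
      using h[of x] by (simp add: w_def power_divide field_simps)
    finally show ?thesis .
  qed
  ultimately obtain A C
    where f: "\<And>x. f x - h x = A * exp (1 / sqrt 2 * x) + C * exp (- (1 / sqrt 2 * x))"
    by (rule second_order_ode_solution) auto
  have "f x = biharmonic_profile A (a / sqrt 2) C (- b / sqrt 2) x" for x
    using f[of x] by (simp add: h_def biharmonic_profile_def algebra_simps)
  then show "\<exists>A B C D. f = biharmonic_profile A B C D" by blast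
next
  assume "\<exists>A B C D. f = biharmonic_profile A B C D"
  then show "\<forall>x. (deriv ^^ 4) f x - (deriv ^^ 2) f x + f x / 4 = 0"
  proof safe
    fix A B C D x
    show "(deriv ^^ 4) (biharmonic_profile A B C D) x - (deriv ^^ 2) (biharmonic_profile A B C D) x
        + biharmonic_profile A B C D x / 4 = 0"
    proof -
      have "((A / 2 + s * B) / 2 + s * (B / 2) + B / 2 / 2 * x) * e
            + ((C / 2 - s * D) / 2 - s * (D / 2) + D / 2 / 2 * x) * e'
          - ((A / 2 + s * B + B / 2 * x) * e + (C / 2 - s * D + D / 2 * x) * e')
          + ((A + B * x) * e + (C + D * x) * e') / 4 = 0" for s e e' :: real
        by (simp add: field_simps)
      moreover have "(deriv ^^ 4) g = deriv (deriv (deriv (deriv g)))"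
        and "(deriv ^^ 2) g = deriv (deriv g)" for g :: "real \<Rightarrow> real"
        by (simp_all add: eval_nat_numeral)
      ultimately show ?thesis
        by (simp only: deriv2_biharmonic_profile biharmonic_profile_def[of _ _ _ _ x])
    qed
  qed
qed

section \<open>The cone away from its vertex\<close>

lemma real2_has_derivative_iff:
  fixes F :: "'a::real_normed_vector \<Rightarrow> real^2"
  shows "(F has_derivative F') (at p) \<longleftrightarrow>
     ((\<lambda>q. F q $ 1) has_derivative (\<lambda>a. F' a $ 1)) (at p) \<and>
     ((\<lambda>q. F q $ 2) has_derivative (\<lambda>a. F' a $ 2)) (at p)"
  unfolding has_derivative_componentwise_within[of F]
  by (auto simp: Basis_vec_def inner_axis UNIV_2)

lemmas ddir_eq = frechet_derivative_at[symmetric]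

lemma nth_has_derivative [derivative_intros]:
  "(F has_derivative F') (at p) \<Longrightarrow> ((\<lambda>q. F q $ i) has_derivative (\<lambda>a. F' a $ i)) (at p)"
  by (rule bounded_linear.has_derivative[OF bounded_linear_vec_nth])

lemma partial_cone_metric:
  "partial l (\<lambda>q. cone_metric q $ i $ j) p = (if l = 1 \<and> i = 2 \<and> j = 2 then p $ 1 else 0)"
proof -
  have g: "cone_metric q $ i $ j = (if i = j then if i = 2 then (q $ 1)\<^sup>2 / 2 else 1 else 0)" for q
    using exhaust_2[of i] exhaust_2[of j] by (auto simp: cone_metric_eq)
  have "((\<lambda>q::real^2. (q $ 1)\<^sup>2 / 2) has_derivative (\<lambda>a. p $ 1 * a $ 1)) (at p)"
    by (auto intro!: derivative_eq_intros)
  then have "((\<lambda>q. cone_metric q $ i $ j) has_derivative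
     (\<lambda>a. if i = 2 \<and> j = 2 then p $ 1 * a $ 1 else 0)) (at p)"
    unfolding g by (cases "i = j"; cases "i = 2") simp_all
  then show ?thesis
    using exhaust_2[of l] by (auto simp: ddir_eq axis_def)
qed

lemma matrix_inv_eqI:
  fixes A B :: "real^'n^'n"
  assumes "A ** B = mat 1"
  shows "matrix_inv A = B"
proof -
  have "A ** matrix_inv A = mat 1 \<and> matrix_inv A ** A = mat 1"
    unfolding matrix_inv_def by (rule someI[of _ B]) (use assms matrix_left_right_inverse in blast)
  with assms show ?thesis
    by (metis matrix_mul_assoc matrix_mul_lid matrix_mul_rid)
qed

lemma matrix_inv_cone_metric:
  assumes "q $ 1 \<noteq> 0"
  shows "matrix_inv (cone_metric q) = vector [vector [1, 0], vector [0, 2 / (q $ 1)\<^sup>2]]"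
proof -
  let ?B = "vector [vector [1, 0], vector [0, 2 / (q $ 1)\<^sup>2]] :: real^2^2"
  have "cone_metric q ** ?B = mat 1"
    using assms by (auto simp: cone_metric_eq vec_eq_iff forall_2 matrix_matrix_mult_def sum_2 mat_def)
  then show ?thesis by (rule matrix_inv_eqI)
qed

lemma christoffel_form_cone:
  assumes "q $ 1 \<noteq> 0"
  shows "christoffel_form cone_metric q a b =
     vector [- (q $ 1) / 2 * a $ 2 * b $ 2, (a $ 1 * b $ 2 + a $ 2 * b $ 1) / q $ 1]"
  using assms
  by (simp add: christoffel_form_def christoffel_def partial_cone_metric matrix_inv_cone_metric
        vec_eq_iff forall_2 sum_2 field_simps power2_eq_square)

lemma open_cone_regular: "open cone_regular"
  unfolding cone_regular_def by (intro open_Collect_neq continuous_intros)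

text \<open>
  For fields with constant components \<open>x\<close>, \<open>y\<close>, \<open>z\<close>, the derivative \<open>\<nabla>\<^sub>x \<nabla>\<^sub>y z\<close> comes out symmetric in
  \<open>x\<close> and \<open>y\<close>, and the bracket of \<open>x\<close> and \<open>y\<close> is zero.
\<close>

lemma curvature_cone:
  assumes p: "p \<in> cone_regular"
  shows "curvature_tensor cone_metric p a b c = 0"
proof -
  note r = cone_regular_def
  have const: "levi_civita cone_metric (\<lambda>_. x) (\<lambda>_. y) q = christoffel_form cone_metric q x y" for x y q
    by (simp add: levi_civita_def)
  have *: "levi_civita cone_metric (\<lambda>_. x) (levi_civita cone_metric (\<lambda>_. y) (\<lambda>_. z)) p =
      vector [- (x $ 1 * y $ 2 * z $ 2 + x $ 2 * y $ 1 * z $ 2 + x $ 2 * y $ 2 * z $ 1) / 2,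
              - (x $ 2 * y $ 2 * z $ 2) / 2]" for x y z
  proof -
    have "((\<lambda>q. vector [- (q $ 1) / 2 * y $ 2 * z $ 2, (y $ 1 * z $ 2 + y $ 2 * z $ 1) / q $ 1] :: real^2)
       has_derivative (\<lambda>a. vector [- (a $ 1) / 2 * y $ 2 * z $ 2,
          - ((y $ 1 * z $ 2 + y $ 2 * z $ 1) * a $ 1 / (p $ 1)\<^sup>2)])) (at p)"
      using p unfolding real2_has_derivative_iff
      by (auto intro!: derivative_eq_intros simp: r power2_eq_square)
    then have "(levi_civita cone_metric (\<lambda>_. y) (\<lambda>_. z) has_derivative (\<lambda>a. vector [- (a $ 1) / 2 * y $ 2 * z $ 2,
          - ((y $ 1 * z $ 2 + y $ 2 * z $ 1) * a $ 1 / (p $ 1)\<^sup>2)])) (at p)"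
      by (rule has_derivative_transform_within_open[OF _ open_cone_regular p])
         (simp add: const christoffel_form_cone r)
    from ddir_eq[OF this] show ?thesis
      using p
      by (simp add: levi_civita_def[of _ _ "levi_civita _ _ _"] const christoffel_form_cone r
            vec_eq_iff forall_2 field_simps power2_eq_square)
  qed
  have "levi_civita cone_metric (lie_bracket (\<lambda>_. a) (\<lambda>_. b)) (\<lambda>_. c) p = 0"
    using p by (simp add: levi_civita_def lie_bracket_def christoffel_form_cone r vec_eq_iff forall_2)
  then show ?thesis
    by (simp add: curvature_tensor_def curvature_op_def * vec_eq_iff forall_2 algebra_simps)
qed

section \<open>Tension and bitension of the map\<close>

lemma metric_trace_flat:
  fixes p :: "real^'n"
  shows "metric_trace flat_metric p T = (\<Sum>i\<in>UNIV. T i i)"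
proof -
  have "matrix_inv (mat 1 :: real^'n^'n) = mat 1"
    by (rule matrix_inv_eqI) simp
  then have "matrix_inv (flat_metric p) $ i $ j *\<^sub>R T i j = (if j = i then T i j else 0)" for i j
    by (simp add: flat_metric_def mat_def)
  then show ?thesis
    by (simp add: metric_trace_def)
qed

lemma levi_civita_flat_coord_field:
  "levi_civita flat_metric (coord_field i) (coord_field j) = (\<lambda>_. 0)"
  by (simp add: fun_eq_iff levi_civita_def coord_field_def christoffel_form_def christoffel_def
        flat_metric_def vec_eq_iff)

lemma cone_map_has_derivative:
  assumes "(f has_real_derivative f') (at (p $ 1))"
  shows "(cone_map f has_derivative (\<lambda>a. vector [f' * a $ 1, a $ 2])) (at p)"
proof -
  have "((\<lambda>q. f (q $ 1)) has_derivative (\<lambda>a. a $ 1 * f')) (at p)"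
    by (rule DERIV_compose_FDERIV[where f = f and g = "\<lambda>q. q $ 1", OF assms]) (auto intro!: derivative_eq_intros)
  then show ?thesis
    unfolding real2_has_derivative_iff cone_map_def
    by (auto intro!: derivative_eq_intros simp: mult.commute)
qed

text \<open>
  All sections occurring in the tension and bitension fields have components that depend on the
  first coordinate only. Covariant derivatives are iterated, so the section \<open>V\<close> may be known in this
  form merely on an open set, namely where \<open>f \<noteq> 0\<close>.
\<close>

lemma pullback_connection_cone_map:
  assumes f: "(f has_real_derivative f') (at (p $ 1))" "f (p $ 1) \<noteq> 0"
    and w: "(w has_real_derivative w') (at (p $ 1))"
    and k: "(k has_real_derivative k') (at (p $ 1))"
    and V: "open U" "p \<in> U" "\<And>q. q \<in> U \<Longrightarrow> V q = vector [w (q $ 1), k (q $ 1)]"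
  shows "pullback_connection cone_metric (cone_map f) X V p =
     vector [w' * X p $ 1 - f (p $ 1) / 2 * X p $ 2 * k (p $ 1),
             k' * X p $ 1 + (f' * X p $ 1 * k (p $ 1) + X p $ 2 * w (p $ 1)) / f (p $ 1)]"
proof -
  have "((\<lambda>q. w (q $ 1)) has_derivative (\<lambda>a. a $ 1 * w')) (at p)"
    by (rule DERIV_compose_FDERIV[where f = w and g = "\<lambda>q. q $ 1", OF w]) (auto intro!: derivative_eq_intros)
  moreover have "((\<lambda>q. k (q $ 1)) has_derivative (\<lambda>a. a $ 1 * k')) (at p)"
    by (rule DERIV_compose_FDERIV[where f = k and g = "\<lambda>q. q $ 1", OF k]) (auto intro!: derivative_eq_intros)
  ultimately have "((\<lambda>q. vector [w (q $ 1), k (q $ 1)] :: real^2) has_derivative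
      (\<lambda>a. vector [w' * a $ 1, k' * a $ 1])) (at p)"
    unfolding real2_has_derivative_iff by (simp add: mult.commute)
  then have "(V has_derivative (\<lambda>a. vector [w' * a $ 1, k' * a $ 1])) (at p)"
    by (rule has_derivative_transform_within_open[OF _ V(1,2)]) (simp add: V(3))
  from ddir_eq[OF this] ddir_eq[OF cone_map_has_derivative[OF f(1)]] V(3)[OF V(2)]
  show ?thesis
    using f(2) by (simp add: pullback_connection_def christoffel_form_cone cone_map_def vec_eq_iff forall_2)
qed

lemma cone_map_domain_iff: "p \<in> cone_map_domain f \<longleftrightarrow> f (p $ 1) \<noteq> 0"
  by (simp add: cone_map_domain_def cone_regular_def cone_map_def)

lemma open_cone_map_domain:
  assumes "\<And>x. isCont f x"
  shows "open (cone_map_domain f)"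
proof -
  have "continuous_on UNIV f"
    using assms by (simp add: continuous_at_imp_continuous_on)
  then have "continuous_on UNIV (\<lambda>p::real^2. f (p $ 1))"
    by (rule continuous_on_compose2) (simp_all add: continuous_on_component)
  moreover have "cone_map_domain f = {p. f (p $ 1) \<noteq> 0}"
    by (auto simp: cone_map_domain_iff)
  ultimately show ?thesis
    by (simp add: open_Collect_neq[OF _ continuous_on_const])
qed

text \<open>
  The contribution \<open>- f / 2\<close> comes from the derivative of \<open>\<partial>\<^sub>v\<close>, the image of \<open>\<partial>\<^sub>y\<close>, in its own direction.
\<close>

lemma tension_cone_map:
  assumes f: "\<And>x. (f has_real_derivative f' x) (at x)"
    and f': "\<And>x. (f' has_real_derivative f'' x) (at x)"
    and p: "p \<in> cone_map_domain f"
  shows "tension_field flat_metric cone_metric (cone_map f) p = vector [f'' (p $ 1) - f (p $ 1) / 2, 0]"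
proof -
  have d: "ddir (cone_map f) q a = vector [f' (q $ 1) * a $ 1, a $ 2]" for q a
    by (simp add: ddir_eq[OF cone_map_has_derivative[OF f]])
  have V: "(\<lambda>q. ddir (cone_map f) q (coord_field j q)) q =
      vector [(if j = 1 then f' (q $ 1) else 0), (if j = 2 then 1 else 0)]" for j q
    using exhaust_2[of j] by (auto simp: d coord_field_def axis_def)
  have c0: "((\<lambda>_. c) has_real_derivative 0) (at x)" for c x :: real
    by simp
  note con = pullback_connection_cone_map[OF f p[unfolded cone_map_domain_iff], where U = UNIV, simplified]
  have "pullback_connection cone_metric (cone_map f) (coord_field 1)
      (\<lambda>q. ddir (cone_map f) q (coord_field 1 q)) p = vector [f'' (p $ 1), 0]"
    by (subst con[OF f' c0[of 0]]) (use V[where j = 1] in \<open>auto simp: coord_field_def axis_def\<close>)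
  moreover have "pullback_connection cone_metric (cone_map f) (coord_field 2)
      (\<lambda>q. ddir (cone_map f) q (coord_field 2 q)) p = vector [- f (p $ 1) / 2, 0]"
    by (subst con[OF c0[of 0] c0[of 1]]) (use V[where j = 2] in \<open>auto simp: coord_field_def axis_def\<close>)
  ultimately show ?thesis
    by (simp add: tension_field_def second_fundamental_form_def metric_trace_flat sum_2
          levi_civita_flat_coord_field d vec_eq_iff forall_2)
qed

text \<open>
  The formula for the tension field holds on the open set where \<open>f \<noteq> 0\<close> and so may be differentiated
  there. Two derivatives in \<open>x\<close> give \<open>w''\<close>, two in \<open>y\<close> give \<open>- w / 2\<close>, and the cone is flat.
\<close>

lemma bitension_cone_map:
  assumes f: "\<And>x. (f has_real_derivative f' x) (at x)"
    and f': "\<And>x. (f' has_real_derivative f'' x) (at x)"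
    and w: "\<And>x. ((\<lambda>x. f'' x - f x / 2) has_real_derivative w' x) (at x)"
    and w': "\<And>x. (w' has_real_derivative w'' x) (at x)"
    and p: "p \<in> cone_map_domain f"
  shows "bitension_field flat_metric cone_metric (cone_map f) p =
    vector [w'' (p $ 1) - (f'' (p $ 1) - f (p $ 1) / 2) / 2, 0]"
proof -
  define w where "w x = f'' x - f x / 2" for x
  define \<tau> where "\<tau> = tension_field flat_metric cone_metric (cone_map f)"
  let ?D = "pullback_connection cone_metric (cone_map f)" and ?U = "cone_map_domain f"
  have U: "open ?U"
    using DERIV_isCont[OF f] by (rule open_cone_map_domain)
  have dw: "(w has_real_derivative w' x) (at x)" for x
    using w by (simp add: w_def[abs_def])
  have c0: "((\<lambda>_. 0) has_real_derivative 0) (at x)" for x :: real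
    by simp
  have \<tau>: "\<tau> q = vector [w (q $ 1), 0]" if "q \<in> ?U" for q
    using tension_cone_map[OF f f' that] by (simp add: \<tau>_def w_def)
  note con = pullback_connection_cone_map[OF f _ _ _ U]
  have D: "?D X \<tau> q = vector [w' (q $ 1) * X q $ 1, X q $ 2 * w (q $ 1) / f (q $ 1)]"
    if "q \<in> ?U" for X q
    by (subst con[OF _ dw c0 that \<tau>]) (use that in \<open>auto simp: cone_map_domain_iff\<close>)
  have "?D (coord_field 1) (?D (coord_field 1) \<tau>) p = vector [w'' (p $ 1), 0]"
    by (subst con[OF _ w' c0 p])
       (use p in \<open>auto simp: cone_map_domain_iff D coord_field_def axis_def\<close>)
  moreover have "?D (coord_field 2) (?D (coord_field 2) \<tau>) p = vector [- w (p $ 1) / 2, 0]"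
  proof -
    have f0: "f (p $ 1) \<noteq> 0" using p by (simp add: cone_map_domain_iff)
    \<comment> \<open>The derivative of \<open>w / f\<close> gets multiplied by the \<open>x\<close>-component of \<open>\<partial>\<^sub>y\<close>, which is zero: existence is enough.\<close>
    obtain k' where k': "((\<lambda>x. w x / f x) has_real_derivative k') (at (p $ 1))"
      using DERIV_divide[OF dw f f0] by blast
    show ?thesis
      by (subst con[OF f0 c0 k' p])
         (use f0 in \<open>auto simp: D coord_field_def axis_def\<close>)
  qed
  moreover have "?D (\<lambda>_. 0) \<tau> p = 0"
    using p by (simp add: D vec_eq_iff forall_2)
  moreover have "curvature_tensor cone_metric (cone_map f p) a b c = 0" for a b c
    using p by (intro curvature_cone) (simp add: cone_map_domain_def)
  ultimately show ?thesis
    by (simp add: bitension_field_def Let_def metric_trace_flat sum_2 levi_civita_flat_coord_field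
          flip: \<tau>_def) (simp add: w_def vec_eq_iff forall_2)
qed

section \<open>The equations on the whole line\<close>

lemma all_first_coordinate_iff: "(\<forall>p :: real^2. P (p $ 1)) \<longleftrightarrow> (\<forall>x. P x)"
proof safe
  fix x
  assume "\<forall>p :: real^2. P (p $ 1)"
  then have "P ((vector [x, 0] :: real^2) $ 1)" by blast
  then show "P x" by simp
qed blast

lemma harmonic_cone_map_iff:
  assumes "smooth_real f"
  shows "harmonic_on (cone_map_domain f) flat_metric cone_metric (cone_map f)
     \<longleftrightarrow> (\<forall>x. (deriv ^^ 2) f x - f x / 2 = 0)"
proof -
  note d = smooth_real_has_derivative[OF assms]
  have t: "tension_field flat_metric cone_metric (cone_map f) p =
      vector [(deriv ^^ 2) f (p $ 1) - f (p $ 1) / 2, 0]" if "p \<in> cone_map_domain f" for p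
    using tension_cone_map[OF d[of 0, simplified] d[of 1, simplified] that] by (simp add: numeral_2_eq_2)
  have "harmonic_on (cone_map_domain f) flat_metric cone_metric (cone_map f)
     \<longleftrightarrow> (\<forall>p :: real^2. f (p $ 1) \<noteq> 0 \<longrightarrow> (deriv ^^ 2) f (p $ 1) - f (p $ 1) / 2 = 0)"
    by (auto simp: harmonic_on_def t cone_map_domain_iff vec_eq_iff forall_2)
  also have "\<dots> \<longleftrightarrow> (\<forall>x. f x \<noteq> 0 \<longrightarrow> (deriv ^^ 2) f x - f x / 2 = 0)"
    by (rule all_first_coordinate_iff)
  also have "\<dots> \<longleftrightarrow> (\<forall>x. (deriv ^^ 2) f x - f x / 2 = 0)"
    using linear_ode_extends_over_zeros[OF assms, where n = 2 and c = "(\<lambda>_. 0)(0 := - 1 / 2, 2 := 1)"]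
    by (auto simp: eval_nat_numeral)
  finally show ?thesis .
qed

lemma biharmonic_cone_map_iff:
  assumes "smooth_real f"
  shows "biharmonic_on (cone_map_domain f) flat_metric cone_metric (cone_map f)
     \<longleftrightarrow> (\<forall>x. (deriv ^^ 4) f x - (deriv ^^ 2) f x + f x / 4 = 0)"
proof -
  note d = smooth_real_has_derivative[OF assms, simplified]
  let ?w' = "\<lambda>x. deriv (deriv (deriv f)) x - deriv f x / 2"
  have w: "((\<lambda>x. deriv (deriv f) x - f x / 2) has_real_derivative ?w' x) (at x)" for x
    using d[of 2 x] d[of 0 x] by (auto intro!: derivative_eq_intros simp: numeral_2_eq_2)
  have w': "(?w' has_real_derivative (deriv ^^ 4) f x - deriv (deriv f) x / 2) (at x)" for x
    using d[of 3 x] d[of 1 x] by (auto intro!: derivative_eq_intros simp: eval_nat_numeral)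
  have t: "bitension_field flat_metric cone_metric (cone_map f) p =
      vector [(deriv ^^ 4) f (p $ 1) - (deriv ^^ 2) f (p $ 1) + f (p $ 1) / 4, 0]"
    if "p \<in> cone_map_domain f" for p
  proof -
    have "a - b / 2 - (b - c / 2) / 2 = a - b + c / 4" for a b c :: real
      by (simp add: field_simps)
    then show ?thesis
      using bitension_cone_map[OF d[of 0, simplified] d[of 1, simplified] w w' that]
      by (simp only:) (simp add: numeral_2_eq_2)
  qed
  have "biharmonic_on (cone_map_domain f) flat_metric cone_metric (cone_map f)
     \<longleftrightarrow> (\<forall>p :: real^2. f (p $ 1) \<noteq> 0 \<longrightarrow>
            (deriv ^^ 4) f (p $ 1) - (deriv ^^ 2) f (p $ 1) + f (p $ 1) / 4 = 0)"
    by (auto simp: biharmonic_on_def t cone_map_domain_iff vec_eq_iff forall_2)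
  also have "\<dots> \<longleftrightarrow> (\<forall>x. f x \<noteq> 0 \<longrightarrow> (deriv ^^ 4) f x - (deriv ^^ 2) f x + f x / 4 = 0)"
    by (rule all_first_coordinate_iff)
  also have "\<dots> \<longleftrightarrow> (\<forall>x. (deriv ^^ 4) f x - (deriv ^^ 2) f x + f x / 4 = 0)"
  proof -
    let ?c = "(\<lambda>_. 0)(0 := 1 / 4, 2 := - 1, 4 := 1) :: nat \<Rightarrow> real"
    have "(\<Sum>k\<le>4. ?c k * (deriv ^^ k) f x) = (deriv ^^ 4) f x - (deriv ^^ 2) f x + f x / 4" for x
      by (simp add: eval_nat_numeral)
    then show ?thesis
      using linear_ode_extends_over_zeros[OF assms, where n = 4 and c = ?c] by auto
  qed
  finally show ?thesis .
qed

section \<open>Biharmonic maps to the cone\<close>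

lemma biharmonic_profile_zero_imp:
  assumes "\<And>x. biharmonic_profile A 0 C 0 x = 0"
  shows "A = 0 \<and> C = 0"
proof -
  have "A + C = 0" "A * exp 1 + C * exp (- 1) = 0"
    using assms[of 0] assms[of "sqrt 2"] by (simp_all add: biharmonic_profile_def)
  then have "A * (exp 1 - exp (- 1)) = 0"
    by (simp add: algebra_simps add_eq_0_iff)
  with \<open>A + C = 0\<close> show ?thesis by simp
qed

theorem corollary3p4:
  fixes f :: "real \<Rightarrow> real"
  assumes "smooth_real f"
  shows "(biharmonic_on (cone_map_domain f) flat_metric cone_metric (cone_map f) \<longleftrightarrow>
           (\<exists>A B C D :: real. \<forall>x. f x =
              (A + B * x) * exp (x / sqrt 2) + (C + D * x) * exp (- x / sqrt 2)))
         \<and> (\<forall>A B C D :: real.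
              (\<forall>x. f x = (A + B * x) * exp (x / sqrt 2) + (C + D * x) * exp (- x / sqrt 2)) \<longrightarrow>
              B\<^sup>2 + D\<^sup>2 \<noteq> 0 \<longrightarrow>
              proper_biharmonic_on (cone_map_domain f) flat_metric cone_metric (cone_map f))"
proof -
  have profile: "(\<forall>x. f x = (A + B * x) * exp (x / sqrt 2) + (C + D * x) * exp (- x / sqrt 2))
     \<longleftrightarrow> f = biharmonic_profile A B C D" for A B C D
    by (simp add: fun_eq_iff biharmonic_profile_def)
  have bi: "biharmonic_on (cone_map_domain f) flat_metric cone_metric (cone_map f) \<longleftrightarrow>
      (\<exists>A B C D. f = biharmonic_profile A B C D)"
    using biharmonic_cone_map_iff[OF assms] fourth_order_ode_iff[OF assms] by simp
  have "\<not> harmonic_on (cone_map_domain f) flat_metric cone_metric (cone_map f)"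
    if f: "f = biharmonic_profile A B C D" and BD: "B\<^sup>2 + D\<^sup>2 \<noteq> 0" for A B C D
  proof
    assume "harmonic_on (cone_map_domain f) flat_metric cone_metric (cone_map f)"
    then have "(deriv ^^ 2) f x - f x / 2 = 0" for x
      using harmonic_cone_map_iff[OF assms] by blast
    then have "biharmonic_profile (sqrt 2 * B) 0 (- sqrt 2 * D) 0 x = 0" for x
      unfolding f biharmonic_profile_tension .
    from biharmonic_profile_zero_imp[OF this] BD show False by simp
  qed
  with bi show ?thesis
    unfolding profile proper_biharmonic_on_def by blast
qed

end
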